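(* Let a quantum linear system in Kalman canonical form be generated by the Hamiltonian $\boldsymbol H=\frac12\boldsymbol x^\top H\boldsymbol x$ and coupling $\boldsymbol L=\Gamma\boldsymbol x$ with $$H=\begin{bmatrix} 0 & H_h^{12} & 0 & 0 \\ H_h^{12\top} & H_h^{22} & H_{12} & H_{13} \\ 0 & H_{12}^\top & H_{co} & 0 \\ 0 & H_{13}^\top & 0 & H_{\bar c\bar o} \end{bmatrix}\ \text{(real symmetric)},\qquad \begin{bmatrix} \Gamma \\ \Gamma^{\#} \end{bmatrix}=\begin{bmatrix} 0 & \Gamma_h & \Gamma_{co} & 0 \end{bmatrix},\qquad \Gamma_{co}=\begin{bmatrix} \Gamma_{co,q} & \Gamma_{co,p} \\ \Gamma_{co,q}^{\#} & \Gamma_{co,p}^{\#} \end{bmatrix},$$ where $\Gamma_{co,q},\Gamma_{co,p}\in\mathbb C^{m\times n_1}$. (i) The system realizes the back-action evading (BAE) measurement of $\boldsymbol q_{\mathrm{out}}$ with respect to $\boldsymbol p_{\mathrm{in}}$, i.e. $\Xi_{\boldsymbol p_{\mathrm{in}}\to\boldsymbol q_{\mathrm{out}}}(s)\equiv0$, if and only if $$\begin{bmatrix} \mathrm{Re}(\Gamma_{co,q}) & \mathrm{Re}(\Gamma_{co,p}) \end{bmatrix}(sI-\mathbb J_{n_1}H_{co})^{-1}\begin{bmatrix} \mathrm{Re}(\Gamma_{co,p}^\top) \\ -\mathrm{Re}(\Gamma_{co,q}^\top) \end{bmatrix}\equiv0.$$ (ii) The system realizes the BAE measurement of $\boldsymbol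 p_{\mathrm{out}}$ with respect to $\boldsymbol q_{\mathrm{in}}$, i.e. $\Xi_{\boldsymbol q_{\mathrm{in}}\to\boldsymbol p_{\mathrm{out}}}(s)\equiv0$, if and only if $$\begin{bmatrix} \mathrm{Im}(\Gamma_{co,q}) & \mathrm{Im}(\Gamma_{co,p}) \end{bmatrix}(sI-\mathbb J_{n_1}H_{co})^{-1}\begin{bmatrix} \mathrm{Im}(\Gamma_{co,p}^\top) \\ -\mathrm{Im}(\Gamma_{co,q}^\top) \end{bmatrix}\equiv0.$$
   Context: Notation: $X^{\#}$ is the entrywise complex conjugate, $X^\dag=(X^{\#})^\top$; $J_k=\mathrm{diag}(I_k,-I_k)$; $\mathbb J_k=\begin{bmatrix} 0 & I_k \\ -I_k & 0 \end{bmatrix}$; $\bar{\mathbb J}_n=\mathrm{diag}(\mathbb J_{n_3},\mathbb J_{n_1},\mathbb J_{n_2})$ with $n=n_1+n_2+n_3$; $V_k=\frac1{\sqrt2}\begin{bmatrix} I_k & I_k \\ -\imath I_k & \imath I_k \end{bmatrix}$; $\breve\Gamma=\begin{bmatrix} \Gamma \\ \Gamma^{\#} \end{bmatrix}$. The vector $\boldsymbol x=[\boldsymbol q_h^\top\ \boldsymbol p_h^\top\ \boldsymbol x_{co}^\top\ \boldsymbol x_{\bar c\bar o}^\top]^\top$ has blocks of lengths $n_3,n_3,2n_1,2n_2$ and satisfies $[\boldsymbol x,\boldsymbol x^\top]=\imath\bar{\mathbb J}_n$. The system generated by $(H,\Gamma)$ is $\dot{\boldsymbol x}=\bar A\boldsymbol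 x+\bar B\boldsymbol u$, $\boldsymbol y=\bar C\boldsymbol x+\boldsymbol u$ with the (real) matrices $\bar A=\bar{\mathbb J}_nH-\frac{\imath}{2}\bar{\mathbb J}_n\breve\Gamma^\dag J_m\breve\Gamma$, $\bar B=\bar{\mathbb J}_n\breve\Gamma^\dag V_m^\dag\mathbb J_m$, $\bar C=V_m\breve\Gamma$; $\boldsymbol u=[\boldsymbol q_{\mathrm{in}}^\top\ \boldsymbol p_{\mathrm{in}}^\top]^\top$, $\boldsymbol y=[\boldsymbol q_{\mathrm{out}}^\top\ \boldsymbol p_{\mathrm{out}}^\top]^\top$, each block of length $m$. Kalman canonical form: with respect to this partition, $$\bar A=\begin{bmatrix} A_h^{11} & A_h^{12} & A_{12} & A_{13} \\ 0 & A_h^{22} & 0 & 0 \\ 0 & A_{21} & A_{co} & 0 \\ 0 & A_{31} & 0 & A_{\bar c\bar o} \end{bmatrix},\quad \bar B=\begin{bmatrix} B_h \\ 0 \\ B_{co} \\ 0 \end{bmatrix},\quad \bar C=\begin{bmatrix} 0 & C_h & C_{co} & 0 \end{bmatrix},$$ the controllable subspace of $(\bar A,\bar B)$ is the span of the $\boldsymbol q_h,\boldsymbol x_{co}$ coordinates, and the unobservable subspace of $(\bar A,\bar C)$ is the span of the $\boldsymbol q_h,\boldsymbol x_{\bar c\bar o}$ coordinates. The transfer function from $\boldsymbol u$ to $\boldsymbol y$ is $C_{co}(sI-A_{co})^{-1}B_{co}+I$. Partition $B_{co}=[B_{co,q}\ B_{co,p}]$ (column blocks of width $m$) and $C_{co}=\begin{bmatrix}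 C_{co,q} \\ C_{co,p} \end{bmatrix}$ (row blocks of height $m$). Then $\Xi_{\boldsymbol p_{\mathrm{in}}\to\boldsymbol q_{\mathrm{out}}}(s)=C_{co,q}(sI-A_{co})^{-1}B_{co,p}$ and $\Xi_{\boldsymbol q_{\mathrm{in}}\to\boldsymbol p_{\mathrm{out}}}(s)=C_{co,p}(sI-A_{co})^{-1}B_{co,q}$. "$\equiv0$" means identically zero as a rational function of $s$. *)

theory Defs
  imports
    "HOL-Computational_Algebra.Polynomial_Factorial"
    "Jordan_Normal_Form.Char_Poly"
    "Jordan_Normal_Form.Gauss_Jordan_Elimination"
    "Jordan_Normal_Form.Matrix_Kernel"
    "Jordan_Normal_Form.VS_Connect"
begin

definition append_cols :: "'a :: zero mat \<Rightarrow> 'a mat \<Rightarrow> 'a mat" (infixr \<open>@\<^sub>c\<close> 68) where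
  "A @\<^sub>c B = four_block_mat A B (0\<^sub>m 0 (dim_col A)) (0\<^sub>m 0 (dim_col B))"

abbreviation conj_mat :: "complex mat \<Rightarrow> complex mat" where
  "conj_mat X \<equiv> map_mat cnj X"

definition dagger :: "complex mat \<Rightarrow> complex mat" where
  "dagger X = transpose_mat (conj_mat X)"

abbreviation cmat :: "real mat \<Rightarrow> complex mat" where
  "cmat X \<equiv> map_mat complex_of_real X"

abbreviation Re_mat :: "complex mat \<Rightarrow> real mat" where
  "Re_mat X \<equiv> map_mat Re X"

abbreviation Im_mat :: "complex mat \<Rightarrow> real mat" where
  "Im_mat X \<equiv> map_mat Im X"

definition J_sign :: "nat \<Rightarrow> 'a :: ring_1 mat" where
  "J_sign k = four_block_mat (1\<^sub>m k) (0\<^sub>m k k) (0\<^sub>m k k) (- 1\<^sub>m k)"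

definition J_symp :: "nat \<Rightarrow> 'a :: ring_1 mat" where
  "J_symp k = four_block_mat (0\<^sub>m k k) (1\<^sub>m k) (- 1\<^sub>m k) (0\<^sub>m k k)"

definition J_bar :: "nat \<Rightarrow> nat \<Rightarrow> nat \<Rightarrow> 'a :: ring_1 mat" where
  "J_bar n1 n2 n3 = diag_block_mat [J_symp n3, J_symp n1, J_symp n2]"

definition V_mat :: "nat \<Rightarrow> complex mat" where
  "V_mat k = complex_of_real (1 / sqrt 2) \<cdot>\<^sub>m
     four_block_mat (1\<^sub>m k) (1\<^sub>m k) (- \<i> \<cdot>\<^sub>m 1\<^sub>m k) (\<i> \<cdot>\<^sub>m 1\<^sub>m k)"

definition breve :: "complex mat \<Rightarrow> complex mat" where
  "breve \<Gamma> = \<Gamma> @\<^sub>r conj_mat \<Gamma>"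

text \<open>
  The coordinates \<open>x = (q_h, p_h, x_co, x_cbar_obar)\<close> have block lengths
  \<open>n3, n3, 2 * n1, 2 * n2\<close> and the commutation matrix of \<open>x\<close> is \<open>\<i> J_bar n1 n2 n3\<close>.
  The matrices \<open>A, B, C\<close> below are real although their defining expressions involve
  complex matrices; \<open>generated_system_ex1\<close> shows that they always exist and are unique.
  The feedthrough matrix is the identity.
\<close>

definition generated_system ::
  "nat \<Rightarrow> nat \<Rightarrow> nat \<Rightarrow> nat \<Rightarrow> real mat \<Rightarrow> complex mat \<Rightarrow> real mat \<Rightarrow> real mat \<Rightarrow> real mat \<Rightarrow> bool"
where
  "generated_system m n1 n2 n3 H \<Gamma> A B C \<longleftrightarrow>
     cmat A = J_bar n1 n2 n3 * cmat H
              - (\<i> / 2) \<cdot>\<^sub>m (J_bar n1 n2 n3 * dagger (breve \<Gamma>) * J_sign m * breve \<Gamma>) \<and>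
     cmat B = J_bar n1 n2 n3 * dagger (breve \<Gamma>) * dagger (V_mat m) * J_symp m \<and>
     cmat C = V_mat m * breve \<Gamma>"

abbreviation vec_span :: "nat \<Rightarrow> 'a :: field vec set \<Rightarrow> 'a vec set" where
  "vec_span n S \<equiv> LinearCombinations.module.span class_ring (module_vec TYPE('a) n) S"

text \<open>The range of \<open>[B, A B, \<dots>, A^(n-1) B]\<close>.\<close>

definition controllable_subspace :: "'a :: field mat \<Rightarrow> 'a mat \<Rightarrow> 'a vec set" where
  "controllable_subspace A B =
     vec_span (dim_row A) (\<Union>k<dim_row A. set (cols (A ^\<^sub>m k * B)))"

text \<open>The kernel of \<open>[C; C A; \<dots>; C A^(n-1)]\<close>; the intersection with \<open>carrier_vec\<close>
  only matters for \<open>n = 0\<close>.\<close>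

definition unobservable_subspace :: "'a :: field mat \<Rightarrow> 'a mat \<Rightarrow> 'a vec set" where
  "unobservable_subspace A C =
     carrier_vec (dim_row A) \<inter> (\<Inter>k<dim_row A. mat_kernel (C * A ^\<^sub>m k))"

definition coord_subspace :: "nat \<Rightarrow> nat set \<Rightarrow> 'a :: field vec set" where
  "coord_subspace n I = vec_span n (unit_vec n ` I)"

text \<open>Rational functions in the indeterminate \<open>s\<close> are elements of \<open>'a poly fract\<close>.\<close>

definition rat_const :: "'a :: field \<Rightarrow> 'a poly fract" where
  "rat_const a = to_fract [:a:]"

definition rat_s :: "'a :: field poly fract" where
  "rat_s = to_fract [:0, 1:]"

text \<open>\<open>(s I - A)^(-1)\<close>; the inverse always exists, as the following lemma shows.\<close>

definition resolvent :: "'a :: field mat \<Rightarrow> 'a poly fract mat" where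
  "resolvent A = the (mat_inverse (rat_s \<cdot>\<^sub>m 1\<^sub>m (dim_row A) - map_mat rat_const A))"

lemma resolvent:
  fixes A :: "'a :: field mat"
  assumes A: "A \<in> carrier_mat n n"
  defines "M \<equiv> rat_s \<cdot>\<^sub>m 1\<^sub>m n - map_mat rat_const A"
  shows "resolvent A \<in> carrier_mat n n" "M * resolvent A = 1\<^sub>m n" "resolvent A * M = 1\<^sub>m n"
proof -
  interpret to_fract: comm_ring_hom "to_fract :: 'a poly \<Rightarrow> 'a poly fract"
    by standard auto
  have M: "M \<in> carrier_mat n n" using A by (auto simp: M_def)
  have "M = map_mat to_fract (char_poly_matrix A)"
    using A by (intro eq_matI)
      (auto simp: M_def char_poly_matrix_def rat_s_def rat_const_def simp flip: to_fract_uminus to_fract_diff)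
  hence "det M = to_fract (char_poly A)"
    by (simp add: char_poly_def)
  moreover have "char_poly A \<noteq> 0" using degree_monic_char_poly[OF A] by auto
  ultimately have "det M \<noteq> 0" by simp
  from det_non_zero_imp_unit[OF M this, of "()"] mat_inverse(1)[OF M, of "()"]
  obtain R where R: "mat_inverse M = Some R" by auto
  have "resolvent A = R" using A R by (simp add: resolvent_def M_def)
  with mat_inverse(2)[OF M R]
  show "resolvent A \<in> carrier_mat n n" "M * resolvent A = 1\<^sub>m n" "resolvent A * M = 1\<^sub>m n"
    by auto
qed

text \<open>\<open>C (s I - A)^(-1) B\<close>\<close>

definition transfer_matrix :: "'a :: field mat \<Rightarrow> 'a mat \<Rightarrow> 'a mat \<Rightarrow> 'a poly fract mat" where
  "transfer_matrix C A B = map_mat rat_const C * resolvent A * map_mat rat_const B"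

lemma conj_mat_mult:
  assumes "X \<in> carrier_mat a b" "Y \<in> carrier_mat b c"
  shows "conj_mat (X * Y) = conj_mat X * conj_mat Y"
proof -
  interpret cnj: comm_ring_hom cnj by standard auto
  show ?thesis using cnj.mat_hom_mult[OF assms] .
qed

lemma conj_real:
  assumes "conj_mat X = X"
  shows "cmat (Re_mat X) = X"
proof (rule eq_matI)
  fix i j assume ij: "i < dim_row X" "j < dim_col X"
  have "cnj (X $$ (i,j)) = X $$ (i,j)"
    using ij arg_cong[OF assms, of "\<lambda>M. M $$ (i,j)"] by auto
  thus "cmat (Re_mat X) $$ (i,j) = X $$ (i,j)"
    using ij by (auto simp: complex_eq_iff)
qed auto

lemma cmat_inj: "cmat X = cmat Y \<Longrightarrow> X = Y"
proof (rule eq_matI)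
  assume e: "cmat X = cmat Y"
  show d: "dim_row X = dim_row Y" "dim_col X = dim_col Y"
    using arg_cong[OF e, of dim_row] arg_cong[OF e, of dim_col] by auto
  fix i j assume "i < dim_row Y" "j < dim_col Y"
  thus "X $$ (i,j) = Y $$ (i,j)"
    using d arg_cong[OF e, of "\<lambda>M. M $$ (i,j)"] by auto
qed

lemma generated_system_ex1:
  assumes H: "H \<in> carrier_mat (n3 + n3 + 2 * n1 + 2 * n2) (n3 + n3 + 2 * n1 + 2 * n2)"
    and \<Gamma>: "\<Gamma> \<in> carrier_mat m (n3 + n3 + 2 * n1 + 2 * n2)"
  shows "\<exists>!(A, B, C). generated_system m n1 n2 n3 H \<Gamma> A B C"
proof -
  define N where "N = n3 + n3 + 2 * n1 + 2 * n2"
  define P :: "complex mat" where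
    "P = four_block_mat (0\<^sub>m m m) (1\<^sub>m m) (1\<^sub>m m) (0\<^sub>m m m)"
  define b where "b = breve \<Gamma>"
  define V where "V = V_mat m"
  define J :: "complex mat" where "J = J_bar n1 n2 n3"
  define S :: "complex mat" where "S = J_sign m"
  define Y :: "complex mat" where "Y = J_symp m"
  have \<Gamma>N: "\<Gamma> \<in> carrier_mat m N" and HN: "cmat H \<in> carrier_mat N N"
    using H \<Gamma> by (auto simp: N_def)
  have [simp]: "P \<in> carrier_mat (m + m) (m + m)" "S \<in> carrier_mat (m + m) (m + m)"
    "Y \<in> carrier_mat (m + m) (m + m)" "V \<in> carrier_mat (m + m) (m + m)"
    by (auto simp: P_def S_def Y_def V_def J_sign_def J_symp_def V_mat_def)
  have b: "b \<in> carrier_mat (m + m) N" using \<Gamma>N by (auto simp: b_def breve_def)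
  have J: "J \<in> carrier_mat N N"
    by (rule carrier_matI) (simp_all add: J_def J_bar_def J_symp_def N_def Let_def)
  have symp: "conj_mat (J_symp k) = J_symp k" for k
    unfolding J_symp_def by (rule eq_matI) auto
  have four: "conj_mat (four_block_mat X X' Z Z') = four_block_mat (conj_mat X) (conj_mat X') (conj_mat Z) (conj_mat Z')"
    if "dim_row X = dim_row X'" "dim_row Z = dim_row Z'" "dim_col X = dim_col Z" "dim_col X' = dim_col Z'" for X X' Z Z'
    by (rule eq_matI) (use that in auto)
  have zero: "conj_mat (0\<^sub>m i j) = 0\<^sub>m i j" for i j
    by (rule eq_matI) auto
  have diag: "conj_mat (diag_block_mat Xs) = diag_block_mat (map conj_mat Xs)" for Xs
  proof (induction Xs)
    case (Cons X Xs)
    have "dim_row (diag_block_mat (map conj_mat Xs)) = dim_row (diag_block_mat Xs)"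
      "dim_col (diag_block_mat (map conj_mat Xs)) = dim_col (diag_block_mat Xs)"
      by (simp_all flip: Cons.IH)
    thus ?case by (simp add: Let_def four zero Cons.IH)
  qed (simp add: zero)
  have cJ: "conj_mat J = J"
    unfolding J_def J_bar_def diag by (simp only: list.map symp)
  have cY: "conj_mat Y = Y"
    unfolding Y_def J_symp_def by (rule eq_matI) auto
  have cS: "conj_mat S = S"
    unfolding S_def J_sign_def by (rule eq_matI) auto
  have cH: "conj_mat (cmat H) = cmat H" by (rule eq_matI) auto
  have PP: "P * P = 1\<^sub>m (m + m)"
    unfolding P_def by (subst mult_four_block_mat[of _ m m _ m _ m _ _ m _ m]) auto
  have PSP: "P * S * P = - S"
    unfolding P_def S_def J_sign_def
    apply (subst mult_four_block_mat[of _ m m _ m _ m _ _ m _ m]; simp)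
    apply (subst mult_four_block_mat[of _ m m _ m _ m _ _ m _ m]; simp)
    apply (rule eq_matI; auto)
    done
  have cb: "conj_mat b = P * b"
  proof -
    have "P * b = four_block_mat (conj_mat \<Gamma>) (0\<^sub>m m 0) \<Gamma> (0\<^sub>m m 0)"
      unfolding P_def b_def breve_def append_rows_def using \<Gamma>N
      by (subst mult_four_block_mat[of _ m m _ m _ m _ _ N _ 0]) auto
    also have "\<dots> = conj_mat b"
      unfolding b_def breve_def append_rows_def using \<Gamma>N
      by (intro eq_matI) auto
    finally show ?thesis ..
  qed
  have cV: "conj_mat V = V * P"
  proof -
    let ?c = "complex_of_real (1 / sqrt 2)"
    let ?B = "four_block_mat (1\<^sub>m m) (1\<^sub>m m) (- \<i> \<cdot>\<^sub>m 1\<^sub>m m) (\<i> \<cdot>\<^sub>m 1\<^sub>m m)"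
    have "V * P = ?c \<cdot>\<^sub>m (?B * P)" unfolding V_def V_mat_def
      by (rule mult_smult_assoc_mat[of _ "m+m" "m+m" _ "m+m"]) auto
    also have "?B * P = four_block_mat (1\<^sub>m m) (1\<^sub>m m) (\<i> \<cdot>\<^sub>m 1\<^sub>m m) (- \<i> \<cdot>\<^sub>m 1\<^sub>m m)"
      unfolding P_def by (subst mult_four_block_mat[of _ m m _ m _ m _ _ m _ m]) auto
    also have "?c \<cdot>\<^sub>m \<dots> = conj_mat V"
      unfolding V_def V_mat_def by (intro eq_matI) auto
    finally show ?thesis ..
  qed
  have Pt: "transpose_mat P = P"
    unfolding P_def by (subst transpose_four_block_mat[of _ m m _ m _ m]) auto
  have cP: "conj_mat P = P"
    unfolding P_def by (rule eq_matI) auto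
  have cd: "conj_mat (dagger X) = dagger (conj_mat X)" for X
    unfolding dagger_def by (rule eq_matI) auto
  have dm: "dagger (X * Z) = dagger Z * dagger X"
    if "X \<in> carrier_mat i j" "Z \<in> carrier_mat j k" for X Z i j k
    unfolding dagger_def conj_mat_mult[OF that] by (rule transpose_mult) (use that in auto)
  have dP: "dagger P = P" by (simp add: dagger_def cP Pt)
  have db: "dagger b \<in> carrier_mat N (m + m)" and dV: "dagger V \<in> carrier_mat (m + m) (m + m)"
    using b by (auto simp: dagger_def)
  have cdb: "conj_mat (dagger b) = dagger b * P"
    unfolding cd cb by (subst dm[of _ "m+m" "m+m" _ N]) (use b dP in auto)
  have cdV: "conj_mat (dagger V) = P * dagger V"
    unfolding cd cV by (subst dm[of _ "m+m" "m+m" _ "m+m"]) (use dP in auto)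
  have assoc: "(X * Z) * W = X * (Z * W)"
    if "X \<in> carrier_mat i j" "Z \<in> carrier_mat j k" "W \<in> carrier_mat k l" for X Z W :: "complex mat" and i j k l
    using that by (rule assoc_mult_mat)
  note mc = mult_carrier_mat
  have Jdb: "J * dagger b \<in> carrier_mat N (m + m)" by (rule mc[OF J db])
  have dbP: "dagger b * P \<in> carrier_mat N (m + m)" by (rule mc[OF db]) simp
  have PS: "P * S \<in> carrier_mat (m + m) (m + m)" by (rule mc[of _ _ "m + m"]) simp_all
  have PdV: "P * dagger V \<in> carrier_mat (m + m) (m + m)" by (rule mc[OF _ dV]) simp
  have Pb: "P * b \<in> carrier_mat (m + m) N" by (rule mc[OF _ b]) simp
  note c = b J HN db dV Jdb dbP PS PdV Pb mc[OF Jdb dV] mc[OF J dbP] mc[OF J HN] mc[OF mc[OF J dbP] PdV]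

  have C: "conj_mat (V * b) = V * b"
  proof -
    have "conj_mat (V * b) = (V * P) * (P * b)"
      by (subst conj_mat_mult[of _ "m+m" "m+m" _ N]) (use c cV cb in auto)
    also have "\<dots> = V * (P * (P * b))"
      by (rule assoc[of _ "m+m" "m+m" _ "m+m" _ N]) (use c in auto)
    also have "P * (P * b) = (P * P) * b"
      by (rule assoc[symmetric, of _ "m+m" "m+m" _ "m+m" _ N]) (use c in auto)
    also have "\<dots> = b" using PP b by simp
    finally show ?thesis .
  qed
  have B: "conj_mat (J * dagger b * dagger V * Y) = J * dagger b * dagger V * Y"
  proof -
    have "conj_mat (J * dagger b * dagger V * Y) = conj_mat (J * dagger b * dagger V) * Y"
      by (subst conj_mat_mult[OF mc[OF Jdb dV], of Y "m + m"]) (simp_all add: cY)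
    also have "conj_mat (J * dagger b * dagger V) = conj_mat (J * dagger b) * (P * dagger V)"
      by (simp only: conj_mat_mult[OF Jdb dV] cdV)
    also have "conj_mat (J * dagger b) = J * (dagger b * P)"
      by (simp only: conj_mat_mult[OF J db] cJ cdb)
    also have "J * (dagger b * P) = J * dagger b * P"
      by (rule assoc[symmetric, of _ N N _ "m+m" _ "m+m"]) (use c in auto)
    also have "J * dagger b * P * (P * dagger V) = J * dagger b * (P * (P * dagger V))"
      by (rule assoc[OF Jdb _ PdV]) simp
    also have "P * (P * dagger V) = (P * P) * dagger V"
      by (rule assoc[symmetric, of _ "m+m" "m+m" _ "m+m" _ "m+m"]) (use c in auto)
    also have "\<dots> = dagger V" using PP dV by simp
    finally show ?thesis .
  qed
  have K: "conj_mat (J * dagger b * S * b) = - (J * dagger b * S * b)"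
  proof -
    have Pc: "P \<in> carrier_mat (m + m) (m + m)" and Sc: "S \<in> carrier_mat (m + m) (m + m)"
      by simp_all
    have "conj_mat (J * dagger b * S * b) = conj_mat (J * dagger b) * conj_mat S * conj_mat b"
      by (simp only: conj_mat_mult[OF mc[OF Jdb Sc] b] conj_mat_mult[OF Jdb Sc])
    also have "\<dots> = J * (dagger b * P) * S * (P * b)"
      by (simp only: conj_mat_mult[OF J db] cJ cdb cS cb)
    also have "J * (dagger b * P) = J * dagger b * P"
      by (rule assoc[OF J db Pc, symmetric])
    also have "J * dagger b * P * S = J * dagger b * (P * S)"
      by (rule assoc[OF Jdb Pc Sc])
    also have "J * dagger b * (P * S) * (P * b) = J * dagger b * (P * S) * P * b"
      by (rule assoc[OF mc[OF Jdb PS] Pc b, symmetric])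
    also have "J * dagger b * (P * S) * P = J * dagger b * (P * S * P)"
      by (rule assoc[OF Jdb PS Pc])
    also have "\<dots> = - (J * dagger b * S)"
      unfolding PSP by (rule uminus_mult_right_mat) (use carrier_matD[OF Jdb] carrier_matD[OF Sc] in metis)
    also have "\<dots> * b = - (J * dagger b * S * b)"
      by (rule uminus_mult_left_mat) (use carrier_matD[OF mc[OF Jdb Sc]] carrier_matD[OF b] in metis)
    finally show ?thesis .
  qed
  let ?K = "J * dagger b * S * b"
  have Kc: "?K \<in> carrier_mat N N" by (rule mc[OF mc[OF Jdb] b]) simp
  have JH: "conj_mat (J * cmat H) = J * cmat H"
    by (simp only: conj_mat_mult[OF J HN] cJ cH)
  let ?A = "J * cmat H - (\<i> / 2) \<cdot>\<^sub>m ?K"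
  have A: "conj_mat ?A = ?A"
  proof (rule eq_matI)
    fix i j assume "i < dim_row ?A" "j < dim_col ?A"
    hence ij: "i < N" "j < N" using Kc by auto
    have JHc: "J * cmat H \<in> carrier_mat N N" using c by auto
    have 1: "cnj (?K $$ (i,j)) = - (?K $$ (i,j))"
      using arg_cong[OF K, of "\<lambda>M. M $$ (i,j)"] ij Kc
      by (metis carrier_matD(1) carrier_matD(2) index_map_mat(1) index_uminus_mat(1))
    have 2: "cnj ((J * cmat H) $$ (i,j)) = (J * cmat H) $$ (i,j)"
      using arg_cong[OF JH, of "\<lambda>M. M $$ (i,j)"] ij JHc
      by (metis carrier_matD(1) carrier_matD(2) index_map_mat(1))
    have 3: "?A $$ (i,j) = (J * cmat H) $$ (i,j) - \<i> / 2 * (?K $$ (i,j))"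
      using ij Kc JHc by (simp del: index_mult_mat)
    have "conj_mat ?A $$ (i,j) = cnj (?A $$ (i,j))"
      using ij Kc JHc by (intro index_map_mat) auto
    also have "\<dots> = ?A $$ (i,j)" unfolding 3 complex_cnj_diff complex_cnj_mult 1 2 by simp
    finally show "conj_mat ?A $$ (i,j) = ?A $$ (i,j)" .
  qed auto
  have "generated_system m n1 n2 n3 H \<Gamma> (Re_mat ?A) (Re_mat (J * dagger b * dagger V * Y)) (Re_mat (V * b))"
    unfolding generated_system_def
    using conj_real[OF A] conj_real[OF B] conj_real[OF C]
    unfolding J_def b_def V_def S_def Y_def by (intro conjI)
  moreover have "A' = A'' \<and> B' = B'' \<and> C' = C''"
    if "generated_system m n1 n2 n3 H \<Gamma> A' B' C'" "generated_system m n1 n2 n3 H \<Gamma> A'' B'' C''"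
    for A' A'' B' B'' C' C''
    using that unfolding generated_system_def by (metis cmat_inj)
  ultimately show ?thesis by (intro ex1I[of _ "(_, _, _)"]) auto
qed

end

theory Submission
  imports Defs
begin

text \<open>
  The identity \<open>V\<^sup>\<dagger> \<J> V = - \<i> J\<close> turns \<open>A\<close> into \<open>\<J>\<^sub>n H + B C / 2\<close>, where \<open>C = \<surd>2 [Re \<Gamma>; Im \<Gamma>]\<close>
  and \<open>B = \<J>\<^sub>n C\<^sup>T \<J>\<^sub>m\<close>. On the co block this reads
  \<open>A\<^sub>c\<^sub>o = \<J> H\<^sub>c\<^sub>o + (B\<^sub>q C\<^sub>q + B\<^sub>p C\<^sub>p) / 2\<close>. As far as the channel from \<open>p\<^sub>i\<^sub>n\<close> to \<open>q\<^sub>o\<^sub>u\<^sub>t\<close> is concerned,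
  \<open>B\<^sub>p C\<^sub>p / 2\<close> is a state feedback and \<open>B\<^sub>q C\<^sub>q / 2\<close> an output injection, and the resolvent
  identity shows that neither of them affects whether the transfer function vanishes. The other
  channel is symmetric.
\<close>

section \<open>Embedding of scalars into the rational functions\<close>

lemma rat_const_ring_hom: "comm_ring_hom (rat_const :: 'a :: field \<Rightarrow> 'a poly fract)"
  by standard (auto simp: rat_const_def simp flip: to_fract_add to_fract_mult one_pCons)

interpretation rat_const: comm_ring_hom rat_const
  by (rule rat_const_ring_hom)

lemma rat_const_eq_0_iff [simp]: "rat_const a = 0 \<longleftrightarrow> a = 0"
  by (simp add: rat_const_def)

section \<open>Algebra of concatenated block matrices\<close>

lemma dim_append_rows [simp]:
  "dim_row (X @\<^sub>r Y) = dim_row X + dim_row Y" "dim_col (X @\<^sub>r Y) = dim_col X"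
  by (simp_all add: append_rows_def)

lemma dim_append_cols [simp]:
  "dim_row (X @\<^sub>c Y) = dim_row X" "dim_col (X @\<^sub>c Y) = dim_col X + dim_col Y"
  by (simp_all add: append_cols_def)

lemma index_append_rows [simp]:
  assumes "i < dim_row X + dim_row Y" "j < dim_col X" "dim_col Y = dim_col X"
  shows "(X @\<^sub>r Y) $$ (i, j) = (if i < dim_row X then X $$ (i, j) else Y $$ (i - dim_row X, j))"
  using assms by (simp add: append_rows_def)

lemma index_append_cols [simp]:
  assumes "i < dim_row X" "j < dim_col X + dim_col Y" "dim_row Y = dim_row X"
  shows "(X @\<^sub>c Y) $$ (i, j) = (if j < dim_col X then X $$ (i, j) else Y $$ (i, j - dim_col X))"
  using assms by (simp add: append_cols_def)

lemma transpose_append_rows: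
  "dim_col X = dim_col Y \<Longrightarrow> transpose_mat (X @\<^sub>r Y) = transpose_mat X @\<^sub>c transpose_mat Y"
  by (rule eq_matI) auto

text \<open>Both concatenations are four-block matrices with blocks of width or height 0, hence the
  zero dimensions in the instantiation. Later this splits \<open>Bco * Cco\<close> into its q and p
  contributions.\<close>

lemma append_cols_mult_append_rows:
  fixes X1 :: "'a :: semiring_0 mat"
  assumes "X1 \<in> carrier_mat n k" "X2 \<in> carrier_mat n l" "Y1 \<in> carrier_mat k p" "Y2 \<in> carrier_mat l p"
  shows "(X1 @\<^sub>c X2) * (Y1 @\<^sub>r Y2) = X1 * Y1 + X2 * Y2"
  unfolding append_cols_def append_rows_def using assms
  by (subst mult_four_block_mat[of _ n k _ l _ 0 _ _ p _ 0]) (auto intro!: eq_matI)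

lemma mult_append_cols:
  assumes "M \<in> carrier_mat k n" "X \<in> carrier_mat n p" "Y \<in> carrier_mat n q"
  shows "M * (X @\<^sub>c Y) = (M * X) @\<^sub>c (M * Y)"
proof (rule eq_matI)
  fix i j assume "i < dim_row ((M * X) @\<^sub>c (M * Y))" "j < dim_col ((M * X) @\<^sub>c (M * Y))"
  hence ij: "i < k" "j < p + q" using assms by auto
  have "col (X @\<^sub>c Y) j = (if j < p then col X j else col Y (j - p))"
    using ij assms by (intro eq_vecI) auto
  thus "(M * (X @\<^sub>c Y)) $$ (i, j) = ((M * X) @\<^sub>c (M * Y)) $$ (i, j)"
    using ij assms by auto
qed auto

lemma append_cols_eq_iff:
  assumes "X \<in> carrier_mat n k" "X' \<in> carrier_mat n k" "Y \<in> carrier_mat n l" "Y' \<in> carrier_mat n l"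
  shows "X @\<^sub>c Y = X' @\<^sub>c Y' \<longleftrightarrow> X = X' \<and> Y = Y'"
proof
  assume e: "X @\<^sub>c Y = X' @\<^sub>c Y'"
  have "X $$ (i, j) = X' $$ (i, j)" if "i < n" "j < k" for i j
    using arg_cong[OF e, of "\<lambda>M. M $$ (i, j)"] that assms by simp
  moreover have "Y $$ (i, j) = Y' $$ (i, j)" if "i < n" "j < l" for i j
    using arg_cong[OF e, of "\<lambda>M. M $$ (i, k + j)"] that assms by simp
  ultimately show "X = X' \<and> Y = Y'" using assms by (auto intro!: eq_matI)
qed simp

lemma append_rows_eq_iff:
  assumes "X \<in> carrier_mat k n" "X' \<in> carrier_mat k n" "Y \<in> carrier_mat l n" "Y' \<in> carrier_mat l n"
  shows "X @\<^sub>r Y = X' @\<^sub>r Y' \<longleftrightarrow> X = X' \<and> Y = Y'"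
proof -
  have "X @\<^sub>r Y = X' @\<^sub>r Y' \<longleftrightarrow> transpose_mat (X @\<^sub>r Y) = transpose_mat (X' @\<^sub>r Y')"
    by (metis transpose_transpose)
  also have "\<dots> \<longleftrightarrow> X = X' \<and> Y = Y'"
    using assms by (simp add: transpose_append_rows append_cols_eq_iff[of _ n k _ _ l])
  finally show ?thesis .
qed

text \<open>This swap is responsible for the crossing of the channels: the input columns for p come
  from the output rows for q, and the input columns for q from the output rows for p with a minus
  sign.\<close>

lemma append_cols_mult_J_symp:
  assumes "X \<in> carrier_mat n k" "Y \<in> carrier_mat n k"
  shows "(X @\<^sub>c Y) * J_symp k = - Y @\<^sub>c X"
  unfolding append_cols_def J_symp_def using assms
  by (subst mult_four_block_mat[of _ n k _ k _ 0 _ _ k _ k]) auto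

lemma J_symp_mult_append_rows:
  assumes "X \<in> carrier_mat k n" "Y \<in> carrier_mat k n"
  shows "J_symp k * (X @\<^sub>r Y) = Y @\<^sub>r - X"
  unfolding append_rows_def J_symp_def using assms
  by (subst mult_four_block_mat[of _ k k _ k _ k _ _ n _ 0]) auto

section \<open>Vanishing transfer functions under output injection and state feedback\<close>

lemma minus_add_mat:
  fixes X Y Z :: "'a :: ab_group_add mat"
  assumes "X \<in> carrier_mat nr nc" "Y \<in> carrier_mat nr nc" "Z \<in> carrier_mat nr nc"
  shows "X - (Y + Z) = (X - Y) - Z"
  using assms by (intro eq_matI) auto

lemma minus_add_cancel_mat:
  fixes X Y :: "'a :: ab_group_add mat"
  assumes "X \<in> carrier_mat nr nc" "Y \<in> carrier_mat nr nc"
  shows "X - Y + Y = X"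
  using assms by (intro eq_matI) auto

text \<open>With \<open>D\<close> and \<open>P\<close> the resolvents of \<open>M\<close> and
  \<open>M + Y * C\<close>, the resolvent identity reads \<open>P = D + P Y C D\<close>.
  Multiplication by \<open>B\<close> on the right produces the factor \<open>C D B = 0\<close>, so
  that \<open>P B = D B\<close>.\<close>

lemma transfer_matrix_output_injection_eq_0:
  fixes M :: "'a :: field mat"
  assumes M: "M \<in> carrier_mat n n" and B: "B \<in> carrier_mat n p"
    and C: "C \<in> carrier_mat q n" and Y: "Y \<in> carrier_mat n q"
    and z: "transfer_matrix C M B = 0\<^sub>m q p"
  shows "transfer_matrix C (M + Y * C) B = 0\<^sub>m q p"
proof -
  let ?r = "map_mat rat_const"
  let ?s = "rat_s \<cdot>\<^sub>m 1\<^sub>m n :: 'a poly fract mat"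
  define M' where "M' = M + Y * C"
  have M': "M' \<in> carrier_mat n n" using M Y C by (auto simp: M'_def)
  define D where "D = resolvent M"
  define P where "P = resolvent M'"
  note D = resolvent[OF M, folded D_def] and P = resolvent[OF M', folded P_def]
  have rM': "?r M' = ?r M + ?r Y * ?r C"
    unfolding M'_def rat_const.mat_hom_mult[OF Y C, symmetric]
    by (rule eq_matI) (use M Y C in \<open>auto simp: rat_const.hom_add simp del: index_mult_mat(1)\<close>)
  have YC: "?r Y * ?r C \<in> carrier_mat n n" using Y C by auto
  have split: "?s - ?r M' = (?s - ?r M) - ?r Y * ?r C"
    unfolding rM' by (rule minus_add_mat[where nr = n and nc = n]) (use M YC in auto)
  have sM: "?s - ?r M \<in> carrier_mat n n" using M by auto
  have rB: "?r B \<in> carrier_mat n p" and rC: "?r C \<in> carrier_mat q n" and rY: "?r Y \<in> carrier_mat n q"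
    using B C Y by auto
  \<comment> \<open>One product, evaluated in two ways: \<open>P\<close> cancels the bracket of
    \<open>M'\<close>, and \<open>D\<close> cancels the bracket of \<open>M\<close>. The order
    \<open>P\<close>, \<open>D\<close> puts \<open>D\<close> to the right of \<open>C\<close>, where
    \<open>C D B\<close> can form.\<close>
  have "P * (?s - ?r M') * D = P * (?s - ?r M) * D - P * (?r Y * ?r C) * D"
    unfolding split using D(1) P(1) sM YC
    by (simp add: mult_minus_distrib_mat[of _ n n _ n] minus_mult_distrib_mat[of _ n n _ _ n])
  moreover have "P * (?s - ?r M') * D = D" using P D by simp
  moreover have "P * (?s - ?r M) * D = P"
    using P D assoc_mult_mat[OF P(1) sM D(1)] by simp
  ultimately have "D = P - P * (?r Y * ?r C) * D" by simp
  hence PD: "P = D + P * (?r Y * ?r C) * D"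
    using minus_add_cancel_mat[OF P(1) mult_carrier_mat[OF mult_carrier_mat[OF P(1) YC] D(1)]] by simp
  have "P * (?r Y * ?r C) * D * ?r B = P * ?r Y * (?r C * D * ?r B)"
    by (simp only: assoc_mult_mat[OF P(1) rY rC, symmetric] assoc_mult_mat[OF mult_carrier_mat[OF P(1) rY] rC D(1)]
        assoc_mult_mat[OF mult_carrier_mat[OF P(1) rY] mult_carrier_mat[OF rC D(1)] rB])
  also have "\<dots> = 0\<^sub>m n p"
    using z P(1) rY by (simp add: transfer_matrix_def D_def)
  finally have "P * ?r B = D * ?r B"
    using P(1) D(1) YC rB by (subst PD) (simp add: add_mult_distrib_mat[of _ n n _ _ p])
  hence "?r C * P * ?r B = ?r C * D * ?r B"
    using P(1) D(1) rC rB by simp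
  thus ?thesis
    using z by (simp add: transfer_matrix_def P_def D_def M'_def)
qed

text \<open>The mirror image of output injection: now \<open>P = D + D B X P\<close>, and
  multiplication by \<open>C\<close> on the left produces \<open>C D B = 0\<close>, so that
  \<open>C P = C D\<close>.\<close>

lemma transfer_matrix_state_feedback_eq_0:
  fixes M :: "'a :: field mat"
  assumes M: "M \<in> carrier_mat n n" and B: "B \<in> carrier_mat n p"
    and C: "C \<in> carrier_mat q n" and X: "X \<in> carrier_mat p n"
    and z: "transfer_matrix C M B = 0\<^sub>m q p"
  shows "transfer_matrix C (M + B * X) B = 0\<^sub>m q p"
proof -
  let ?r = "map_mat rat_const"
  let ?s = "rat_s \<cdot>\<^sub>m 1\<^sub>m n :: 'a poly fract mat"
  define M' where "M' = M + B * X"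
  have M': "M' \<in> carrier_mat n n" using M B X by (auto simp: M'_def)
  define D where "D = resolvent M"
  define P where "P = resolvent M'"
  note D = resolvent[OF M, folded D_def] and P = resolvent[OF M', folded P_def]
  have rM': "?r M' = ?r M + ?r B * ?r X"
    unfolding M'_def rat_const.mat_hom_mult[OF B X, symmetric]
    by (rule eq_matI) (use M B X in \<open>auto simp: rat_const.hom_add simp del: index_mult_mat(1)\<close>)
  have BX: "?r B * ?r X \<in> carrier_mat n n" using B X by auto
  have split: "?s - ?r M' = (?s - ?r M) - ?r B * ?r X"
    unfolding rM' by (rule minus_add_mat[where nr = n and nc = n]) (use M BX in auto)
  have sM: "?s - ?r M \<in> carrier_mat n n" using M by auto
  have rB: "?r B \<in> carrier_mat n p" and rC: "?r C \<in> carrier_mat q n" and rX: "?r X \<in> carrier_mat p n"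
    using B C X by auto
  have sM': "?s - ?r M' \<in> carrier_mat n n" using M' by auto
  \<comment> \<open>The two resolvents trade places compared with output injection, so that
    \<open>D\<close> stands to the left of \<open>B\<close>.\<close>
  have "D * (?s - ?r M') * P = D * (?s - ?r M) * P - D * (?r B * ?r X) * P"
    unfolding split using D(1) P(1) sM BX
    by (simp add: mult_minus_distrib_mat[of _ n n _ n] minus_mult_distrib_mat[of _ n n _ _ n])
  moreover have "D * (?s - ?r M) * P = P" using P D by simp
  moreover have "D * (?s - ?r M') * P = D"
    using P D assoc_mult_mat[OF D(1) sM' P(1)] by simp
  ultimately have "D = P - D * (?r B * ?r X) * P" by simp
  hence PD: "P = D + D * (?r B * ?r X) * P"
    using minus_add_cancel_mat[OF P(1) mult_carrier_mat[OF mult_carrier_mat[OF D(1) BX] P(1)]] by simp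
  have "?r C * (D * (?r B * ?r X) * P) = ?r C * D * ?r B * (?r X * P)"
    by (simp only: assoc_mult_mat[OF D(1) rB rX, symmetric] assoc_mult_mat[OF mult_carrier_mat[OF D(1) rB] rX P(1)]
        assoc_mult_mat[OF rC mult_carrier_mat[OF D(1) rB] mult_carrier_mat[OF rX P(1)], symmetric]
        assoc_mult_mat[OF rC D(1) rB])
  also have "\<dots> = 0\<^sub>m q n"
    using z P(1) rX by (simp add: transfer_matrix_def D_def)
  finally have "?r C * P = ?r C * D"
    using P(1) D(1) BX rC by (subst PD) (simp add: mult_add_distrib_mat[of _ q n _ n])
  thus ?thesis
    using z by (simp add: transfer_matrix_def P_def D_def M'_def)
qed

text \<open>One direction applies state feedback and then output injection. Both operations are
  undone by the gains \<open>- X\<close> and \<open>- Y\<close>, so the converse is the same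
  argument started at the perturbed matrix.\<close>

lemma transfer_matrix_feedback_eq_0_iff:
  fixes M :: "'a :: field mat"
  assumes M: "M \<in> carrier_mat n n" and B: "B \<in> carrier_mat n p"
    and C: "C \<in> carrier_mat q n" and X: "X \<in> carrier_mat p n" and Y: "Y \<in> carrier_mat n q"
  shows "transfer_matrix C (M + B * X + Y * C) B = 0\<^sub>m q p \<longleftrightarrow> transfer_matrix C M B = 0\<^sub>m q p"
proof
  assume "transfer_matrix C M B = 0\<^sub>m q p"
  thus "transfer_matrix C (M + B * X + Y * C) B = 0\<^sub>m q p"
    using assms by (intro transfer_matrix_output_injection_eq_0 transfer_matrix_state_feedback_eq_0) auto
next
  let ?N = "M + B * X + Y * C"
  have N: "?N \<in> carrier_mat n n" using assms by auto
  assume "transfer_matrix C ?N B = 0\<^sub>m q p"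
  hence "transfer_matrix C (?N + B * (- X) + (- Y) * C) B = 0\<^sub>m q p"
    using assms N
    by (intro transfer_matrix_output_injection_eq_0[where n = n and q = q and p = p, OF _ B C _
          transfer_matrix_state_feedback_eq_0[where n = n and q = q and p = p, OF N B C _]]) auto
  also have "B * (- X) = - (B * X)" using B X by simp
  also have "(- Y) * C = - (Y * C)" using C Y by simp
  also have "?N + - (B * X) + - (Y * C) = M"
    by (rule eq_matI) (use M B C X Y in \<open>auto simp del: index_mult_mat(1)\<close>)
  finally show "transfer_matrix C M B = 0\<^sub>m q p" .
qed

text \<open>Used to discard the factors \<open>sqrt 2\<close> and \<open>- sqrt 2\<close> in front
  of the output and input matrices. A nonzero scalar stays nonzero under \<open>rat_const\<close>,
  and the rational functions form a field.\<close>

lemma transfer_matrix_smult_eq_0_iff: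
  fixes M :: "'a :: field mat"
  assumes M: "M \<in> carrier_mat n n" and B: "B \<in> carrier_mat n p" and C: "C \<in> carrier_mat q n"
    and "a \<noteq> 0" "b \<noteq> 0"
  shows "transfer_matrix (a \<cdot>\<^sub>m C) M (b \<cdot>\<^sub>m B) = 0\<^sub>m q p \<longleftrightarrow> transfer_matrix C M B = 0\<^sub>m q p"
proof -
  let ?T = "transfer_matrix C M B"
  note R = resolvent(1)[OF M]
  have rB: "map_mat rat_const B \<in> carrier_mat n p" and rC: "map_mat rat_const C \<in> carrier_mat q n"
    using B C by auto
  have T: "?T \<in> carrier_mat q p"
    using R rB rC by (auto simp: transfer_matrix_def)
  have hom: "map_mat rat_const (c \<cdot>\<^sub>m S) = rat_const c \<cdot>\<^sub>m map_mat rat_const S"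
    for c and S :: "'a mat"
    by (rule eq_matI) (auto simp: rat_const.hom_mult)
  have "transfer_matrix (a \<cdot>\<^sub>m C) M (b \<cdot>\<^sub>m B) = rat_const b \<cdot>\<^sub>m (rat_const a \<cdot>\<^sub>m ?T)"
    using R rB rC
    by (simp add: transfer_matrix_def hom mult_smult_assoc_mat[of _ q n _ n]
        mult_smult_assoc_mat[of _ q n _ p] mult_smult_distrib[of _ q n _ p])
  moreover have "c \<cdot>\<^sub>m S = 0\<^sub>m q p \<longleftrightarrow> S = 0\<^sub>m q p"
    if "c \<noteq> 0" "S \<in> carrier_mat q p" for c :: "'a poly fract" and S
    using that by (auto simp: mat_eq_iff)
  ultimately show ?thesis using assms T by simp
qed

section \<open>Symplectic, signature and quadrature matrices\<close>

lemma carrier_J_symp [simp]: "J_symp k \<in> carrier_mat (2 * k) (2 * k)"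
  by (simp add: J_symp_def mult_2)

lemma carrier_J_sign [simp]: "J_sign k \<in> carrier_mat (2 * k) (2 * k)"
  by (simp add: J_sign_def mult_2)

lemma carrier_V_mat [simp]: "V_mat k \<in> carrier_mat (2 * k) (2 * k)"
  by (simp add: V_mat_def mult_2)

lemma dim_J_symp [simp]: "dim_row (J_symp k) = 2 * k" "dim_col (J_symp k) = 2 * k"
  using carrier_J_symp by blast+

text \<open>Unfolds the recursion of \<open>diag_block_mat\<close> and drops its empty last block,
  leaving nested four-block matrices whose entries can be computed by simplification.\<close>

lemma J_bar_four_block:
  "J_bar n1 n2 n3 = four_block_mat (J_symp n3) (0\<^sub>m (2 * n3) (2 * n1 + 2 * n2)) (0\<^sub>m (2 * n1 + 2 * n2) (2 * n3))
     (four_block_mat (J_symp n1) (0\<^sub>m (2 * n1) (2 * n2)) (0\<^sub>m (2 * n2) (2 * n1)) (J_symp n2))"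
  by (intro eq_matI) (auto simp: J_bar_def Let_def)

lemma carrier_J_bar [simp]:
  "J_bar n1 n2 n3 \<in> carrier_mat (n3 + n3 + 2 * n1 + 2 * n2) (n3 + n3 + 2 * n1 + 2 * n2)"
  by (intro carrier_matI) (auto simp: J_bar_four_block)

lemma dim_J_bar [simp]:
  "dim_row (J_bar n1 n2 n3) = n3 + n3 + 2 * n1 + 2 * n2"
  "dim_col (J_bar n1 n2 n3) = n3 + n3 + 2 * n1 + 2 * n2"
  using carrier_J_bar by blast+

text \<open>\<open>J_symp\<close> is polymorphic, so its real and complex instances have to be
  identified before the real system matrices can be compared with their complex defining
  formulas.\<close>

lemma cmat_J_symp: "cmat (J_symp k) = J_symp k"
  by (rule eq_matI) (auto simp: J_symp_def)

lemma cmat_J_bar: "cmat (J_bar n1 n2 n3) = J_bar n1 n2 n3"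
proof (rule eq_matI)
  have J: "complex_of_real (J_symp k $$ (i, j)) = J_symp k $$ (i, j)" if "i < 2 * k" "j < 2 * k" for k i j
    using that
    by (subst cmat_J_symp[symmetric], subst index_map_mat) auto
  fix i j assume "i < dim_row (J_bar n1 n2 n3 :: complex mat)" "j < dim_col (J_bar n1 n2 n3 :: complex mat)"
  thus "cmat (J_bar n1 n2 n3) $$ (i, j) = J_bar n1 n2 n3 $$ (i, j)"
    by (auto simp: J_bar_four_block J)
qed auto

lemma smult_smult_mat: "a \<cdot>\<^sub>m (b \<cdot>\<^sub>m X) = (a * b :: 'a :: semigroup_mult) \<cdot>\<^sub>m X"
  by (rule eq_matI) (auto simp: mult.assoc)

text \<open>The change from annihilation and creation operators to quadratures carries the
  symplectic form to the signature form, up to the factor \<open>- \<i>\<close>. This is what makes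
  \<open>J_sign\<close> in the definition of \<open>A\<close> expressible through
  \<open>B * C\<close>.\<close>

lemma dagger_V_J_symp_V: "dagger (V_mat m) * J_symp m * V_mat m = - \<i> \<cdot>\<^sub>m J_sign m"
proof -
  define c where "c = complex_of_real (1 / sqrt 2)"
  let ?B = "four_block_mat (1\<^sub>m m) (1\<^sub>m m) (- \<i> \<cdot>\<^sub>m 1\<^sub>m m) (\<i> \<cdot>\<^sub>m 1\<^sub>m m) :: complex mat"
  let ?D = "four_block_mat (1\<^sub>m m) (\<i> \<cdot>\<^sub>m 1\<^sub>m m) (1\<^sub>m m) (- \<i> \<cdot>\<^sub>m 1\<^sub>m m) :: complex mat"
  have cc: "c * c = 1 / 2"
    by (simp add: c_def flip: of_real_mult)
  have d: "dagger (V_mat m) = c \<cdot>\<^sub>m ?D"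
    by (rule eq_matI) (auto simp: dagger_def V_mat_def c_def)
  have J: "J_symp m \<in> carrier_mat (m + m) (m + m)"
    using carrier_J_symp[of m] by (simp add: mult_2)
  have B: "?B \<in> carrier_mat (m + m) (m + m)" and D: "?D \<in> carrier_mat (m + m) (m + m)" by auto
  have "dagger (V_mat m) * J_symp m * V_mat m = (c * c) \<cdot>\<^sub>m (?D * J_symp m * ?B)"
    unfolding d unfolding V_mat_def c_def[symmetric] using J B D
    by (simp only: mult_smult_assoc_mat[OF D J] mult_smult_assoc_mat[OF mult_carrier_mat[OF D J] smult_carrier_mat[OF B]]
        mult_smult_distrib[OF mult_carrier_mat[OF D J] B] smult_smult_mat)
  also have "?D * J_symp m = four_block_mat (- \<i> \<cdot>\<^sub>m 1\<^sub>m m) (1\<^sub>m m) (\<i> \<cdot>\<^sub>m 1\<^sub>m m) (1\<^sub>m m)"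
    unfolding J_symp_def
    by (subst mult_four_block_mat[of _ m m _ m _ m _ _ m _ m]) (auto intro!: eq_matI)
  also have "\<dots> * ?B = (- 2 * \<i>) \<cdot>\<^sub>m J_sign m"
    unfolding J_sign_def
    by (subst mult_four_block_mat[of _ m m _ m _ m _ _ m _ m]) (auto intro!: eq_matI)
  finally show ?thesis unfolding cc by (simp add: smult_smult_mat)
qed

text \<open>The two block rows of \<open>V_mat\<close> form \<open>z + cnj z\<close> and
  \<open>- \<i> * z + \<i> * cnj z\<close>, that is, twice the real and twice the imaginary part;
  the factor \<open>2 / sqrt 2\<close> is \<open>sqrt 2\<close>. Hence q outputs see real parts and
  p outputs imaginary parts.\<close>

lemma V_breve:
  assumes "G \<in> carrier_mat m n"
  shows "V_mat m * breve G = cmat (sqrt 2 \<cdot>\<^sub>m (Re_mat G @\<^sub>r Im_mat G))"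
proof -
  define c where "c = complex_of_real (1 / sqrt 2)"
  let ?B = "four_block_mat (1\<^sub>m m) (1\<^sub>m m) (- \<i> \<cdot>\<^sub>m 1\<^sub>m m) (\<i> \<cdot>\<^sub>m 1\<^sub>m m) :: complex mat"
  have b: "breve G \<in> carrier_mat (m + m) n" using assms by (auto simp: breve_def)
  have "1 / sqrt 2 * 2 = sqrt 2" by (simp add: real_div_sqrt)
  hence "c * 2 = complex_of_real (sqrt 2)" unfolding c_def by (metis of_real_mult of_real_numeral)
  hence c: "c * (2 * z) = complex_of_real (sqrt 2) * z" for z by (simp flip: mult.assoc)
  have "?B * breve G = four_block_mat (G + conj_mat G) (0\<^sub>m m 0) (- \<i> \<cdot>\<^sub>m G + \<i> \<cdot>\<^sub>m conj_mat G) (0\<^sub>m m 0)"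
    unfolding breve_def append_rows_def using assms
    by (subst mult_four_block_mat[of _ m m _ m _ m _ _ n _ 0]) auto
  moreover have "V_mat m * breve G = c \<cdot>\<^sub>m (?B * breve G)"
    unfolding V_mat_def c_def[symmetric] using b by (intro mult_smult_assoc_mat[of _ "m+m" "m+m" _ n]) auto
  moreover have "c \<cdot>\<^sub>m four_block_mat (G + conj_mat G) (0\<^sub>m m 0) (- \<i> \<cdot>\<^sub>m G + \<i> \<cdot>\<^sub>m conj_mat G) (0\<^sub>m m 0)
      = cmat (sqrt 2 \<cdot>\<^sub>m (Re_mat G @\<^sub>r Im_mat G))" (is "?L = ?R")
  proof (rule eq_matI)
    fix i j assume "i < dim_row ?R" "j < dim_col ?R"
    hence ij: "i < m + m" "j < n" using assms by (auto simp: append_rows_def)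
    have re: "z + cnj z = 2 * of_real (Re z)" and im: "\<i> * cnj z - \<i> * z = 2 * of_real (Im z)" for z
      by (auto simp: complex_eq_iff)
    show "?L $$ (i, j) = ?R $$ (i, j)"
      using ij assms by (auto simp: re im c)
  qed (use assms in \<open>auto simp: append_rows_def\<close>)
  ultimately show ?thesis by simp
qed

section \<open>Real form of the generated system matrices\<close>

lemma dagger_mult:
  assumes "X \<in> carrier_mat a b" "Y \<in> carrier_mat b c"
  shows "dagger (X * Y) = dagger Y * dagger X"
  unfolding dagger_def conj_mat_mult[OF assms] by (rule transpose_mult) (use assms in auto)

lemma dagger_cmat: "dagger (cmat X) = cmat (transpose_mat X)"
  by (rule eq_matI) (auto simp: dagger_def)

text \<open>Write \<open>b\<close> for \<open>breve \<Gamma>\<close>. Since \<open>C = V b\<close>,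
  the product \<open>B C\<close> contains the middle factor
  \<open>dagger V * J_symp m * V = - \<i> J_sign m\<close>, so \<open>B C / 2\<close> is exactly the
  dissipative term of \<open>A\<close>. All three identities are proved over the complex numbers and
  pulled back by injectivity of \<open>cmat\<close>.\<close>

lemma generated_system_real:
  assumes H: "H \<in> carrier_mat (n3 + n3 + 2 * n1 + 2 * n2) (n3 + n3 + 2 * n1 + 2 * n2)"
    and G: "\<Gamma> \<in> carrier_mat m (n3 + n3 + 2 * n1 + 2 * n2)"
    and sys: "generated_system m n1 n2 n3 H \<Gamma> A B C"
  shows "C = sqrt 2 \<cdot>\<^sub>m (Re_mat \<Gamma> @\<^sub>r Im_mat \<Gamma>)"
    and "B = J_bar n1 n2 n3 * transpose_mat C * J_symp m"
    and "A = J_bar n1 n2 n3 * H + (1 / 2) \<cdot>\<^sub>m (B * C)"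
proof -
  define N where "N = n3 + n3 + 2 * n1 + 2 * n2"
  define J where "J = (J_bar n1 n2 n3 :: real mat)"
  define b where "b = breve \<Gamma>"
  define V where "V = V_mat m"
  have J: "J \<in> carrier_mat N N" and cJ: "cmat J \<in> carrier_mat N N" and J_eq: "J_bar n1 n2 n3 = cmat J"
    by (auto simp: J_def N_def cmat_J_bar)
  have b: "b \<in> carrier_mat (2 * m) N" using G by (auto simp: b_def breve_def append_rows_def N_def)
  have V: "V \<in> carrier_mat (2 * m) (2 * m)" by (simp add: V_def)
  have db: "dagger b \<in> carrier_mat N (2 * m)" and dV: "dagger V \<in> carrier_mat (2 * m) (2 * m)"
    using b V by (auto simp: dagger_def)
  have cC: "cmat C = V * b" and cB: "cmat B = cmat J * dagger b * dagger V * J_symp m"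
    and cA: "cmat A = cmat J * cmat H - (\<i> / 2) \<cdot>\<^sub>m (cmat J * dagger b * J_sign m * b)"
    using sys unfolding generated_system_def V_def b_def J_eq by blast+
  show C_eq: "C = sqrt 2 \<cdot>\<^sub>m (Re_mat \<Gamma> @\<^sub>r Im_mat \<Gamma>)"
    by (rule cmat_inj) (use cC V_breve[OF G] in \<open>simp add: V_def b_def\<close>)
  have C: "C \<in> carrier_mat (2 * m) N" using C_eq G by (auto simp: mult_2 N_def)
  \<comment> \<open>\<open>C\<close> is real, so its transpose becomes a dagger after embedding, and
    the dagger of \<open>V b\<close> splits into the two factors occurring in
    \<open>B\<close>.\<close>
  have "cmat (J * transpose_mat C * J_symp m) = cmat J * dagger (cmat C) * J_symp m"
    using J C
    by (simp add: dagger_cmat cmat_J_symp of_real_hom.mat_hom_mult[of _ N "2*m" _ "2*m"] of_real_hom.mat_hom_mult[of _ N N _ "2*m"])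
  also have "dagger (cmat C) = dagger b * dagger V"
    unfolding cC by (rule dagger_mult[OF V b])
  also have "cmat J * (dagger b * dagger V) = cmat J * dagger b * dagger V"
    by (rule assoc_mult_mat[symmetric, OF cJ db dV])
  finally show B_eq: "B = J_bar n1 n2 n3 * transpose_mat C * J_symp m"
    using cB by (intro cmat_inj) (simp add: J_def)
  have B: "B \<in> carrier_mat N (2 * m)"
    unfolding B_eq J_def[symmetric]
    by (rule mult_carrier_mat[OF mult_carrier_mat[OF J] carrier_J_symp]) (use C in simp)
  have S: "J_sign m \<in> carrier_mat (2 * m) (2 * m)" and Y: "J_symp m \<in> carrier_mat (2 * m) (2 * m)" by auto
  have K: "cmat J * dagger b \<in> carrier_mat N (2 * m)" and dVY: "dagger V * J_symp m \<in> carrier_mat (2 * m) (2 * m)"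
    using mult_carrier_mat[OF cJ db] mult_carrier_mat[OF dV Y] by auto
  have "cmat B * cmat C = cmat J * dagger b * (dagger V * J_symp m * V) * b"
    unfolding cB cC
    by (simp only: assoc_mult_mat[OF K dV Y] assoc_mult_mat[OF mult_carrier_mat[OF K dVY] V b, symmetric]
        assoc_mult_mat[OF K dVY V])
  also have "dagger V * J_symp m * V = - \<i> \<cdot>\<^sub>m J_sign m"
    unfolding V_def by (rule dagger_V_J_symp_V)
  also have "cmat J * dagger b * (- \<i> \<cdot>\<^sub>m J_sign m) * b = - \<i> \<cdot>\<^sub>m (cmat J * dagger b * J_sign m * b)"
    using mult_carrier_mat[OF cJ db] b S
    by (simp add: mult_smult_distrib[of _ N "2*m" _ "2*m"] mult_smult_assoc_mat[of _ N "2*m" _ N])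
  finally have BC: "cmat (B * C) = - \<i> \<cdot>\<^sub>m (cmat J * dagger b * J_sign m * b)"
    using B C by (simp add: of_real_hom.mat_hom_mult[of _ N "2*m" _ N])
  have L: "cmat J * dagger b * J_sign m * b \<in> carrier_mat N N"
    by (rule mult_carrier_mat[OF mult_carrier_mat[OF mult_carrier_mat[OF cJ db] S] b])
  have HN: "H \<in> carrier_mat N N" using H by (simp add: N_def)
  have JH: "J * H \<in> carrier_mat N N" and BCc: "B * C \<in> carrier_mat N N" using J HN B C by auto
  have "cmat (J * H + (1 / 2) \<cdot>\<^sub>m (B * C)) = cmat (J * H) + (1 / 2) \<cdot>\<^sub>m cmat (B * C)"
  proof -
    have "cmat (X + (1 / 2) \<cdot>\<^sub>m Y) = cmat X + (1 / 2) \<cdot>\<^sub>m cmat Y"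
      if "X \<in> carrier_mat N N" "Y \<in> carrier_mat N N" for X Y
      by (rule eq_matI) (use that in auto)
    thus ?thesis using JH BCc .
  qed
  also have "\<dots> = cmat A"
    unfolding BC cA of_real_hom.mat_hom_mult[OF J HN]
    by (rule eq_matI) (use L cJ HN in \<open>auto simp del: index_mult_mat(1)\<close>)
  finally show "A = J_bar n1 n2 n3 * H + (1 / 2) \<cdot>\<^sub>m (B * C)"
    by (intro cmat_inj) (simp add: J_def)
qed

section \<open>Selection matrices for extracting blocks\<close>

text \<open>The rows \<open>r\<close> to \<open>r + k - 1\<close> of the identity matrix of size
  \<open>n\<close> (when \<open>r + k \<le> n\<close>). Expressing block extraction as
  multiplication lets blocks of a product be computed by associativity.\<close>

definition sel_mat :: "nat \<Rightarrow> nat \<Rightarrow> nat \<Rightarrow> 'a :: semiring_1 mat" where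
  "sel_mat r k n = mat k n (\<lambda>(i, j). if j = r + i then 1 else 0)"

lemma carrier_sel_mat [simp]: "sel_mat r k n \<in> carrier_mat k n"
  by (simp add: sel_mat_def)

lemma sel_mat_mult:
  fixes M :: "'a :: comm_semiring_1 mat"
  assumes "M \<in> carrier_mat n c" "r + k \<le> n"
  shows "sel_mat r k n * M = mat k c (\<lambda>(i, j). M $$ (r + i, j))"
proof (rule eq_matI)
  fix i j assume "i < dim_row (mat k c (\<lambda>(i, j). M $$ (r + i, j)))" "j < dim_col (mat k c (\<lambda>(i, j). M $$ (r + i, j)))"
  hence ij: "i < k" "j < c" by auto
  have "(sel_mat r k n * M) $$ (i, j) = (\<Sum>l = 0..<n. (if l = r + i then M $$ (l, j) else 0))"
    using assms ij by (simp add: sel_mat_def scalar_prod_def if_distrib[of "\<lambda>x. x * _"] cong: if_cong)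
  also have "\<dots> = M $$ (r + i, j)"
    using assms ij by simp
  finally show "(sel_mat r k n * M) $$ (i, j) = mat k c (\<lambda>(i, j). M $$ (r + i, j)) $$ (i, j)"
    using ij by simp
qed (use assms in \<open>auto simp: sel_mat_def\<close>)

lemma mult_sel_mat_transpose:
  fixes M :: "'a :: comm_semiring_1 mat"
  assumes "M \<in> carrier_mat c n" "r + k \<le> n"
  shows "M * transpose_mat (sel_mat r k n) = mat c k (\<lambda>(i, j). M $$ (i, r + j))"
proof -
  have "M * transpose_mat (sel_mat r k n) = transpose_mat (sel_mat r k n * transpose_mat M)"
    using assms by (subst transpose_mult[of _ k n _ c]) auto
  also have "\<dots> = mat c k (\<lambda>(i, j). M $$ (i, r + j))"
    using assms by (subst sel_mat_mult[of _ n c]) (auto intro!: eq_matI)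
  finally show ?thesis .
qed

lemma mult_sel_mat:
  fixes M :: "'a :: comm_semiring_1 mat"
  assumes "M \<in> carrier_mat c k"
  shows "M * sel_mat r k n = mat c n (\<lambda>(i, j). if r \<le> j \<and> j < r + k then M $$ (i, j - r) else 0)"
    (is "_ = ?R")
proof (rule eq_matI)
  fix i j assume "i < dim_row ?R" "j < dim_col ?R"
  hence ij: "i < c" "j < n" by auto
  \<comment> \<open>The guard \<open>r \<le> j\<close> stays in the summand because natural
    subtraction truncates: for \<open>j < r\<close> the index \<open>j - r\<close> would wrongly hit
    0.\<close>
  have "(M * sel_mat r k n) $$ (i, j) = (\<Sum>l = 0..<k. (if r \<le> j \<and> l = j - r then M $$ (i, l) else 0))"
    using assms ij by (auto simp: sel_mat_def scalar_prod_def intro!: sum.cong)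
  also have "\<dots> = (if r \<le> j \<and> j < r + k then M $$ (i, j - r) else 0)"
    by (cases "r \<le> j") auto
  finally show "(M * sel_mat r k n) $$ (i, j) = ?R $$ (i, j)"
    using ij by simp
qed (use assms in \<open>auto simp: sel_mat_def\<close>)

text \<open>Block diagonality makes the selection of the co coordinates intertwine
  \<open>J_bar\<close> with \<open>J_symp n1\<close>. Thus the selection passes through
  \<open>J_bar\<close> and acts directly on the factor behind it.\<close>

lemma sel_mat_J_bar:
  fixes n1 n2 n3 :: nat
  defines "N \<equiv> n3 + n3 + 2 * n1 + 2 * n2"
  shows "sel_mat (n3 + n3) (2 * n1) N * J_bar n1 n2 n3
    = (J_symp n1 * sel_mat (n3 + n3) (2 * n1) N :: 'a :: comm_ring_1 mat)"
  unfolding mult_sel_mat[OF carrier_J_symp] N_def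
  by (subst sel_mat_mult[OF carrier_J_bar], simp) (rule eq_matI; auto simp: J_bar_four_block simp flip: mult_2)

theorem theorem4p1:
  fixes m n1 n2 n3 :: nat
    and H Hh12 Hh22 H12 H13 Hco Hcc :: "real mat"
    and \<Gamma> \<Gamma>h \<Gamma>co \<Gamma>coq \<Gamma>cop :: "complex mat"
    and A B C Ah11 Ah12 A12 A13 Ah22 A21 Aco A31 Acc :: "real mat"
    and Bh Bco Bcoq Bcop Ch Cco Ccoq Ccop :: "real mat"
  assumes H_blocks:
      "Hh12 \<in> carrier_mat n3 n3" "Hh22 \<in> carrier_mat n3 n3"
      "H12 \<in> carrier_mat n3 (2 * n1)" "H13 \<in> carrier_mat n3 (2 * n2)"
      "Hco \<in> carrier_mat (2 * n1) (2 * n1)" "Hcc \<in> carrier_mat (2 * n2) (2 * n2)"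
    and H:
      "H = (0\<^sub>m n3 n3             @\<^sub>c Hh12                @\<^sub>c 0\<^sub>m n3 (2 * n1)       @\<^sub>c 0\<^sub>m n3 (2 * n2))
        @\<^sub>r (transpose_mat Hh12   @\<^sub>c Hh22                @\<^sub>c H12                  @\<^sub>c H13)
        @\<^sub>r (0\<^sub>m (2 * n1) n3       @\<^sub>c transpose_mat H12   @\<^sub>c Hco                  @\<^sub>c 0\<^sub>m (2 * n1) (2 * n2))
        @\<^sub>r (0\<^sub>m (2 * n2) n3       @\<^sub>c transpose_mat H13   @\<^sub>c 0\<^sub>m (2 * n2) (2 * n1) @\<^sub>c Hcc)"
    and H_sym: "transpose_mat H = H"
    and \<Gamma>_blocks:
      "\<Gamma> \<in> carrier_mat m (n3 + n3 + 2 * n1 + 2 * n2)"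
      "\<Gamma>h \<in> carrier_mat (2 * m) n3"
      "\<Gamma>coq \<in> carrier_mat m n1" "\<Gamma>cop \<in> carrier_mat m n1"
    and \<Gamma>: "breve \<Gamma> = 0\<^sub>m (2 * m) n3 @\<^sub>c \<Gamma>h @\<^sub>c \<Gamma>co @\<^sub>c 0\<^sub>m (2 * m) (2 * n2)"
    and \<Gamma>co: "\<Gamma>co = four_block_mat \<Gamma>coq \<Gamma>cop (conj_mat \<Gamma>coq) (conj_mat \<Gamma>cop)"
    and system: "generated_system m n1 n2 n3 H \<Gamma> A B C"
    and A_blocks:
      "Ah11 \<in> carrier_mat n3 n3" "Ah12 \<in> carrier_mat n3 n3"
      "A12 \<in> carrier_mat n3 (2 * n1)" "A13 \<in> carrier_mat n3 (2 * n2)"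
      "Ah22 \<in> carrier_mat n3 n3"
      "A21 \<in> carrier_mat (2 * n1) n3" "Aco \<in> carrier_mat (2 * n1) (2 * n1)"
      "A31 \<in> carrier_mat (2 * n2) n3" "Acc \<in> carrier_mat (2 * n2) (2 * n2)"
    and kalman_A:
      "A = (Ah11           @\<^sub>c Ah12 @\<^sub>c A12                  @\<^sub>c A13)
        @\<^sub>r (0\<^sub>m n3 n3       @\<^sub>c Ah22 @\<^sub>c 0\<^sub>m n3 (2 * n1)       @\<^sub>c 0\<^sub>m n3 (2 * n2))
        @\<^sub>r (0\<^sub>m (2 * n1) n3 @\<^sub>c A21  @\<^sub>c Aco                  @\<^sub>c 0\<^sub>m (2 * n1) (2 * n2))
        @\<^sub>r (0\<^sub>m (2 * n2) n3 @\<^sub>c A31  @\<^sub>c 0\<^sub>m (2 * n2) (2 * n1) @\<^sub>c Acc)"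
    and B_blocks:
      "Bh \<in> carrier_mat n3 (2 * m)"
      "Bcoq \<in> carrier_mat (2 * n1) m" "Bcop \<in> carrier_mat (2 * n1) m"
    and kalman_B:
      "B = Bh @\<^sub>r 0\<^sub>m n3 (2 * m) @\<^sub>r Bco @\<^sub>r 0\<^sub>m (2 * n2) (2 * m)" "Bco = Bcoq @\<^sub>c Bcop"
    and C_blocks:
      "Ch \<in> carrier_mat (2 * m) n3"
      "Ccoq \<in> carrier_mat m (2 * n1)" "Ccop \<in> carrier_mat m (2 * n1)"
    and kalman_C:
      "C = 0\<^sub>m (2 * m) n3 @\<^sub>c Ch @\<^sub>c Cco @\<^sub>c 0\<^sub>m (2 * m) (2 * n2)" "Cco = Ccoq @\<^sub>r Ccop"
    and controllable:
      "controllable_subspace A B =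
         coord_subspace (n3 + n3 + 2 * n1 + 2 * n2)
           ({0..<n3} \<union> {n3 + n3..<n3 + n3 + 2 * n1})"
    and unobservable:
      "unobservable_subspace A C =
         coord_subspace (n3 + n3 + 2 * n1 + 2 * n2)
           ({0..<n3} \<union> {n3 + n3 + 2 * n1..<n3 + n3 + 2 * n1 + 2 * n2})"
  shows
    "(transfer_matrix Ccoq Aco Bcop = 0\<^sub>m m m \<longleftrightarrow>
        transfer_matrix (Re_mat \<Gamma>coq @\<^sub>c Re_mat \<Gamma>cop) (J_symp n1 * Hco)
          (Re_mat (transpose_mat \<Gamma>cop) @\<^sub>r - Re_mat (transpose_mat \<Gamma>coq)) = 0\<^sub>m m m) \<and>
     (transfer_matrix Ccop Aco Bcoq = 0\<^sub>m m m \<longleftrightarrow>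
        transfer_matrix (Im_mat \<Gamma>coq @\<^sub>c Im_mat \<Gamma>cop) (J_symp n1 * Hco)
          (Im_mat (transpose_mat \<Gamma>cop) @\<^sub>r - Im_mat (transpose_mat \<Gamma>coq)) = 0\<^sub>m m m)"
proof -

  \<comment> \<open>Compression of the system to the co block\<close>
  define N where "N = n3 + n3 + 2 * n1 + 2 * n2"
  define E where "E = (sel_mat (n3 + n3) (2 * n1) N :: real mat)"
  define J where "J = (J_symp n1 :: real mat)"
  let ?R = "Re_mat \<Gamma>coq @\<^sub>c Re_mat \<Gamma>cop" and ?I = "Im_mat \<Gamma>coq @\<^sub>c Im_mat \<Gamma>cop"
  have E: "E \<in> carrier_mat (2 * n1) N" and J: "J \<in> carrier_mat (2 * n1) (2 * n1)"
    by (simp_all add: E_def J_def)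
  have le: "n3 + n3 + 2 * n1 \<le> N" by (simp add: N_def)
  note blocks = H_blocks \<Gamma>_blocks A_blocks B_blocks C_blocks
  note dims = blocks[THEN carrier_matD(1)] blocks[THEN carrier_matD(2)]
  have HN: "H \<in> carrier_mat N N" and AN: "A \<in> carrier_mat N N"
    and BN: "B \<in> carrier_mat N (2 * m)" and CN: "C \<in> carrier_mat (2 * m) N"
    unfolding H kalman_A kalman_B kalman_C N_def by (rule carrier_matI; simp add: dims)+
  \<comment> \<open>Compression by \<open>E\<close> on both sides cuts out the diagonal block of the
    co coordinates, which start at index \<open>n3 + n3\<close>.\<close>
  have block: "E * M * transpose_mat E = mat (2 * n1) (2 * n1) (\<lambda>(i, j). M $$ (n3 + n3 + i, n3 + n3 + j))"
    if "M \<in> carrier_mat N N" for M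
    unfolding E_def sel_mat_mult[OF that le]
    by (subst mult_sel_mat_transpose[OF _ le]) (use le in \<open>auto intro!: eq_matI\<close>)
  have HE: "E * H * transpose_mat E = Hco"
    unfolding block[OF HN] by (rule eq_matI) (simp_all add: H dims)
  have AE: "E * A * transpose_mat E = Aco"
    unfolding block[OF AN] by (rule eq_matI) (simp_all add: kalman_A dims)
  have BE: "E * B = Bco"
    unfolding E_def sel_mat_mult[OF BN le] by (rule eq_matI) (simp_all add: kalman_B dims)
  have CE: "C * transpose_mat E = Cco"
    unfolding E_def mult_sel_mat_transpose[OF CN le] by (rule eq_matI) (simp_all add: kalman_C dims)
  note real = generated_system_real[OF HN[unfolded N_def] \<Gamma>_blocks(1) system]
  have Cco: "Cco \<in> carrier_mat (2 * m) (2 * n1)" and Bco: "Bco \<in> carrier_mat (2 * n1) (2 * m)"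
    unfolding kalman_B kalman_C by (rule carrier_matI; simp add: dims)+
  have EJ: "E * J_bar n1 n2 n3 = J * E"
    unfolding E_def J_def N_def by (rule sel_mat_J_bar)
  have Jb: "(J_bar n1 n2 n3 :: real mat) \<in> carrier_mat N N" unfolding N_def by (rule carrier_J_bar)
  have Js: "(J_symp m :: real mat) \<in> carrier_mat (2 * m) (2 * m)" by simp
  have Et: "transpose_mat E \<in> carrier_mat N (2 * n1)" and Ct: "transpose_mat C \<in> carrier_mat N (2 * m)"
    using E CN by auto
  \<comment> \<open>Moving \<open>E\<close> past \<open>J_bar\<close> shows that the co block
    satisfies the same relation between input and output matrix as the full system.\<close>
  have "Bco = E * J_bar n1 n2 n3 * transpose_mat C * J_symp m"
    unfolding BE[symmetric] real(2)
    by (simp only: assoc_mult_mat[OF E mult_carrier_mat[OF Jb Ct] Js, symmetric] assoc_mult_mat[OF E Jb Ct, symmetric])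
  also have "\<dots> = J * (E * transpose_mat C) * J_symp m"
    unfolding EJ using assoc_mult_mat[OF J E Ct] by simp
  also have "E * transpose_mat C = transpose_mat Cco"
    unfolding CE[symmetric] using transpose_mult[OF CN Et] by simp
  finally have Bco_eq: "Bco = J * transpose_mat Cco * J_symp m" .
  have JbH: "J_bar n1 n2 n3 * H \<in> carrier_mat N N" and BC: "(1 / 2) \<cdot>\<^sub>m (B * C) \<in> carrier_mat N N"
    using Jb HN BN CN by auto
  \<comment> \<open>Each summand compresses separately: the Hamiltonian part by the intertwining
    relation, and \<open>B * C\<close> as \<open>(E * B) * (C * transpose_mat E)\<close>.\<close>
  have "Aco = E * (J_bar n1 n2 n3 * H) * transpose_mat E + E * ((1 / 2) \<cdot>\<^sub>m (B * C)) * transpose_mat E"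
    unfolding AE[symmetric] real(3) using E Et JbH BC
    by (simp add: mult_add_distrib_mat[OF E JbH BC] add_mult_distrib_mat[of _ "2*n1" N _ _ "2*n1"])
  also have "E * (J_bar n1 n2 n3 * H) * transpose_mat E = J * (E * H * transpose_mat E)"
    using assoc_mult_mat[OF E Jb HN] assoc_mult_mat[OF J E HN] EJ
      assoc_mult_mat[OF J mult_carrier_mat[OF E HN] Et] by simp
  also have "E * ((1 / 2) \<cdot>\<^sub>m (B * C)) * transpose_mat E = (1 / 2) \<cdot>\<^sub>m (E * (B * C) * transpose_mat E)"
    using mult_smult_distrib[OF E mult_carrier_mat[OF BN CN]]
      mult_smult_assoc_mat[OF mult_carrier_mat[OF E mult_carrier_mat[OF BN CN]] Et] by simp
  also have "E * (B * C) * transpose_mat E = Bco * Cco"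
    using assoc_mult_mat[OF E BN CN] assoc_mult_mat[OF mult_carrier_mat[OF E BN] CN Et] BE CE by simp
  finally have Aco_eq: "Aco = J * Hco + (1 / 2) \<cdot>\<^sub>m (Bco * Cco)" unfolding HE .

  \<comment> \<open>Separation of the q and p channels\<close>
  have BqCq: "Bcoq * Ccoq \<in> carrier_mat (2 * n1) (2 * n1)" and BpCp: "Bcop * Ccop \<in> carrier_mat (2 * n1) (2 * n1)"
    and JH: "J * Hco \<in> carrier_mat (2 * n1) (2 * n1)"
    using J blocks by (auto intro!: mult_carrier_mat[of _ _ m])
  have "Bco * Cco = Bcoq * Ccoq + Bcop * Ccop"
    unfolding kalman_B(2) kalman_C(2) by (rule append_cols_mult_append_rows) fact+
  hence Aco_sum: "Aco = J * Hco + (1 / 2) \<cdot>\<^sub>m (Bcoq * Ccoq + Bcop * Ccop)"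
    unfolding Aco_eq by simp
  have half: "X + (1 / 2) \<cdot>\<^sub>m (Y + Z) = X + (1 / 2) \<cdot>\<^sub>m Z + (1 / 2) \<cdot>\<^sub>m Y"
    "X + (1 / 2) \<cdot>\<^sub>m (Y + Z) = X + (1 / 2) \<cdot>\<^sub>m Y + (1 / 2) \<cdot>\<^sub>m Z"
    if "X \<in> carrier_mat k k" "Y \<in> carrier_mat k k" "Z \<in> carrier_mat k k" for X Y Z :: "real mat" and k
    by (rule eq_matI; use that in \<open>auto simp: algebra_simps add_divide_distrib\<close>)+
  \<comment> \<open>For the channel from p to q, the \<open>Bcop\<close> term is a state feedback
    with gain \<open>Ccop / 2\<close>, and the \<open>Ccoq\<close> term an output injection with
    gain \<open>Bcoq / 2\<close>. The next grouping of the same sum exchanges these roles.\<close>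
  have Aco_p: "Aco = J * Hco + Bcop * ((1 / 2) \<cdot>\<^sub>m Ccop) + ((1 / 2) \<cdot>\<^sub>m Bcoq) * Ccoq"
    unfolding Aco_sum half(1)[OF JH BqCq BpCp]
    by (simp only: mult_smult_distrib[OF B_blocks(3) C_blocks(3)] mult_smult_assoc_mat[OF B_blocks(2) C_blocks(2)])
  have Aco_q: "Aco = J * Hco + Bcoq * ((1 / 2) \<cdot>\<^sub>m Ccoq) + ((1 / 2) \<cdot>\<^sub>m Bcop) * Ccop"
    unfolding Aco_sum half(2)[OF JH BqCq BpCp]
    by (simp only: mult_smult_distrib[OF B_blocks(2) C_blocks(2)] mult_smult_assoc_mat[OF B_blocks(3) C_blocks(3)])
  have JCt: "J * transpose_mat Ccoq \<in> carrier_mat (2 * n1) m" "J * transpose_mat Ccop \<in> carrier_mat (2 * n1) m"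
    using J blocks by (auto intro!: mult_carrier_mat[of _ _ "2 * n1"])
  have "Bcoq @\<^sub>c Bcop = (J * (transpose_mat Ccoq @\<^sub>c transpose_mat Ccop)) * J_symp m"
    using Bco_eq unfolding kalman_B(2) kalman_C(2) by (simp add: transpose_append_rows dims)
  also have "J * (transpose_mat Ccoq @\<^sub>c transpose_mat Ccop) = (J * transpose_mat Ccoq) @\<^sub>c (J * transpose_mat Ccop)"
    by (rule mult_append_cols[OF J]) (use C_blocks in auto)
  also have "\<dots> * J_symp m = - (J * transpose_mat Ccop) @\<^sub>c (J * transpose_mat Ccoq)"
    by (rule append_cols_mult_J_symp) (use JCt in auto)
  finally have Bco_qp: "Bcoq = - (J * transpose_mat Ccop)" "Bcop = J * transpose_mat Ccoq"
    using append_cols_eq_iff[OF B_blocks(2) _ B_blocks(3) JCt(1)] JCt(2) by auto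
  \<comment> \<open>The first \<open>m\<close> rows of \<open>breve \<Gamma>\<close> are
    \<open>\<Gamma>\<close> itself, so its co columns can be read off from the upper half of
    \<open>\<Gamma>co\<close>.\<close>
  have \<Gamma>_entry: "\<Gamma> $$ (i, n3 + n3 + j) = (\<Gamma>coq @\<^sub>c \<Gamma>cop) $$ (i, j)" if "i < m" "j < 2 * n1" for i j
    using that le arg_cong[OF \<Gamma>, of "\<lambda>M. M $$ (i, n3 + n3 + j)"]
    by (simp add: breve_def \<Gamma>co dims N_def)
  have Cco_entries: "Cco = (sqrt 2 \<cdot>\<^sub>m ?R) @\<^sub>r (sqrt 2 \<cdot>\<^sub>m ?I)"
    unfolding CE[symmetric] E_def mult_sel_mat_transpose[OF CN le]
    unfolding real(1)
    by (rule eq_matI) (simp_all add: \<Gamma>_entry dims)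
  have Rc: "?R \<in> carrier_mat m (2 * n1)" and Ic: "?I \<in> carrier_mat m (2 * n1)"
    by (rule carrier_matI; simp add: dims)+
  have Cco_qp: "Ccoq = sqrt 2 \<cdot>\<^sub>m ?R" "Ccop = sqrt 2 \<cdot>\<^sub>m ?I"
    using Cco_entries append_rows_eq_iff[OF C_blocks(2) _ C_blocks(3)] Rc Ic
    unfolding kalman_C(2) by auto
  \<comment> \<open>The symplectic matrix swaps the transposed row blocks, which yields the order
    and the sign of the input vectors in the two criteria.\<close>
  have J_app: "J * transpose_mat (c \<cdot>\<^sub>m (X @\<^sub>c Y)) = c \<cdot>\<^sub>m (transpose_mat Y @\<^sub>r - transpose_mat X)"
    if XY: "X \<in> carrier_mat m n1" "Y \<in> carrier_mat m n1" for c and X Y :: "real mat"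
  proof -
    have "transpose_mat X @\<^sub>r transpose_mat Y \<in> carrier_mat (2 * n1) m"
      by (rule carrier_matI) (use XY in auto)
    moreover have "transpose_mat (c \<cdot>\<^sub>m (X @\<^sub>c Y)) = c \<cdot>\<^sub>m (transpose_mat X @\<^sub>r transpose_mat Y)"
      by (rule eq_matI) (use XY in auto)
    ultimately show ?thesis
      using XY J_symp_mult_append_rows[of "transpose_mat X" n1 m "transpose_mat Y"] mult_smult_distrib[OF J]
      by (simp add: J_def)
  qed
  have Bcop: "Bcop = sqrt 2 \<cdot>\<^sub>m (Re_mat (transpose_mat \<Gamma>cop) @\<^sub>r - Re_mat (transpose_mat \<Gamma>coq))" (is "_ = _ \<cdot>\<^sub>m ?BR")
    unfolding Bco_qp Cco_qp using J_app[of "Re_mat \<Gamma>coq" "Re_mat \<Gamma>cop"] \<Gamma>_blocks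
    by (simp add: map_mat_transpose)
  \<comment> \<open>The sign left by \<open>J_symp m\<close> is moved into the scalar, where it is a
    harmless nonzero factor.\<close>
  have Bcoq: "Bcoq = (- sqrt 2) \<cdot>\<^sub>m (Im_mat (transpose_mat \<Gamma>cop) @\<^sub>r - Im_mat (transpose_mat \<Gamma>coq))" (is "_ = _ \<cdot>\<^sub>m ?BI")
  proof -
    have "Bcoq = - (sqrt 2 \<cdot>\<^sub>m ?BI)"
      unfolding Bco_qp Cco_qp using J_app[of "Im_mat \<Gamma>coq" "Im_mat \<Gamma>cop"] \<Gamma>_blocks
      by (simp add: map_mat_transpose)
    also have "\<dots> = (- sqrt 2) \<cdot>\<^sub>m ?BI" by (rule eq_matI) auto
    finally show ?thesis .
  qed
  have BR: "?BR \<in> carrier_mat (2 * n1) m" and BI: "?BI \<in> carrier_mat (2 * n1) m"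
    by (rule carrier_matI; simp add: dims)+
  \<comment> \<open>Both dissipative terms are removed at once, leaving the purely Hamiltonian drift
    \<open>J * Hco\<close>; after that only nonzero scalar factors separate each channel from its
    criterion.\<close>
  have "transfer_matrix Ccoq Aco Bcop = 0\<^sub>m m m \<longleftrightarrow> transfer_matrix Ccoq (J * Hco) Bcop = 0\<^sub>m m m"
    unfolding Aco_p using JH B_blocks C_blocks by (intro transfer_matrix_feedback_eq_0_iff) auto
  moreover have "transfer_matrix Ccop Aco Bcoq = 0\<^sub>m m m \<longleftrightarrow> transfer_matrix Ccop (J * Hco) Bcoq = 0\<^sub>m m m"
    unfolding Aco_q using JH B_blocks C_blocks by (intro transfer_matrix_feedback_eq_0_iff) auto
  moreover have "transfer_matrix Ccoq (J * Hco) Bcop = 0\<^sub>m m m \<longleftrightarrow> transfer_matrix ?R (J * Hco) ?BR = 0\<^sub>m m m"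
    unfolding Bcop Cco_qp using JH BR Rc by (intro transfer_matrix_smult_eq_0_iff) auto
  moreover have "transfer_matrix Ccop (J * Hco) Bcoq = 0\<^sub>m m m \<longleftrightarrow> transfer_matrix ?I (J * Hco) ?BI = 0\<^sub>m m m"
    unfolding Bcoq Cco_qp using JH BI Ic by (intro transfer_matrix_smult_eq_0_iff) auto
  ultimately show ?thesis unfolding J_def by simp
qed

end
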